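(* Let $A\in\mathbb{R}^{k\times r}$, $\mathbf{a}\in\mathbb{R}^r$, $\mathbf{b}\in\mathbb{R}^l$ and $B\in\mathbb{R}^{l\times s}$, and suppose $M=\begin{bmatrix}A\\ \mathbf{a}^T\end{bmatrix}$ and $N=\left[\begin{array}{c|c}\mathbf{b} & B\end{array}\right]$ are row orthogonal (i.e. $MM^T=I$ and $NN^T=I$), where $\mathbf{a}$ and $\mathbf{b}$ are nowhere zero. Then $$Q=\begin{bmatrix}A & O\\ \mathbf{b}\mathbf{a}^T & B\end{bmatrix}$$ is row orthogonal. Further, $Q$ has the strong inner product property if and only if both $M$ and $N$ have the strong inner product property.
   Context: All matrices are real; $\circ$ denotes the Hadamard product; a vector is nowhere zero if all of its entries are nonzero. A matrix $P\in\mathbb{R}^{p\times q}$ with $p\le q$ has the strong inner product property (SIPP) if $P$ has rank $p$ and $X=O$ is the only symmetric $p\times p$ matrix $X$ with $(XP)\circ P=O$. *)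

theory Defs
  imports "Jordan_Normal_Form.DL_Rank"
begin

definition append_cols :: "'a :: zero mat \<Rightarrow> 'a mat \<Rightarrow> 'a mat" (infixr \<open>@\<^sub>c\<close> 65) where
  "A @\<^sub>c B = four_block_mat A B (0\<^sub>m 0 (dim_col A)) (0\<^sub>m 0 (dim_col B))"

definition hadamard_mat :: "'a :: times mat \<Rightarrow> 'a mat \<Rightarrow> 'a mat" (infixl \<open>\<circ>\<^sub>m\<close> 70) where
  "A \<circ>\<^sub>m B = mat (dim_row A) (dim_col A) (\<lambda>ij. A $$ ij * B $$ ij)"

definition mat_of_col :: "'a vec \<Rightarrow> 'a mat" where
  "mat_of_col v = mat_of_cols (dim_vec v) [v]"

definition nowhere_zero :: "'a :: zero vec \<Rightarrow> bool" where
  "nowhere_zero v \<longleftrightarrow> (\<forall>i < dim_vec v. v $ i \<noteq> 0)"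

definition row_orthogonal :: "real mat \<Rightarrow> bool" where
  "row_orthogonal P \<longleftrightarrow> P * P\<^sup>T = 1\<^sub>m (dim_row P)"

definition SIPP :: "real mat \<Rightarrow> bool" where
  "SIPP P \<longleftrightarrow>
     dim_row P \<le> dim_col P \<and>
     vec_space.rank (dim_row P) P = dim_row P \<and>
     (\<forall>X \<in> carrier_mat (dim_row P) (dim_row P).
        X\<^sup>T = X \<and> (X * P) \<circ>\<^sub>m P = 0\<^sub>m (dim_row P) (dim_col P)
        \<longrightarrow> X = 0\<^sub>m (dim_row P) (dim_row P))"

end

theory Submission
  imports Defs
begin

text \<open>M, N and Q have one common shape: P = [A O; C B] with C nowhere zero. For M the block C
  is a^T and there are no further columns; for N there are no upper rows and C = b; for Q, C = b
  a^T. Let such a P be row orthogonal and write a symmetric X as [Y Z; Z^T W]. As C has no zero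
  entry, the lower left block of (X P) o P = O says Z^T A + W C = O. Since A A^T = I and C A^T = O,
  multiplying by A^T leaves Z = O, and the condition splits into (Y A) o A = O for Y, and W C = O
  with (W B) o B = O for W. So P has the SIPP iff A has it and the only symmetric W meeting the
  second condition is O (\<open>SIPP_block_triangular_iff\<close>). Because a is a unit vector, W
  a^T = O forces W = O, so M has the SIPP iff A does; and W b a^T = O iff W b = O, so Q and N put
  the same condition on W. Hence the SIPP of Q is that of M and N together. Row orthogonality of Q
  follows blockwise from A a = O and a^T a = 1 (\<open>row_orthogonal_block_triangular_iff\<close>),
  and it makes the rank clause of the SIPP automatic (\<open>rank_row_orthogonal\<close>).\<close>

section \<open>Block matrices and the Hadamard product\<close>

lemma four_block_mat_eq_iff:
  assumes "A \<in> carrier_mat m p" "B \<in> carrier_mat m q" "C \<in> carrier_mat n p" "D \<in> carrier_mat n q"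
    and "A' \<in> carrier_mat m p" "B' \<in> carrier_mat m q" "C' \<in> carrier_mat n p" "D' \<in> carrier_mat n q"
  shows "four_block_mat A B C D = four_block_mat A' B' C' D' \<longleftrightarrow>
    A = A' \<and> B = B' \<and> C = C' \<and> D = D'" (is "?F = ?F' \<longleftrightarrow> ?R")
proof
  assume eq: "?F = ?F'"
  have *: "?F $$ (i, j) = ?F' $$ (i, j)" for i j
    using eq by simp
  show ?R
  proof (intro conjI)
    show "A = A'"
    proof (rule eq_matI)
      fix i j assume "i < dim_row A'" "j < dim_col A'"
      with *[of i j] assms show "A $$ (i, j) = A' $$ (i, j)" by simp
    qed (use assms in auto)
    show "B = B'"
    proof (rule eq_matI)
      fix i j assume "i < dim_row B'" "j < dim_col B'"
      with *[of i "p + j"] assms show "B $$ (i, j) = B' $$ (i, j)" by simp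
    qed (use assms in auto)
    show "C = C'"
    proof (rule eq_matI)
      fix i j assume "i < dim_row C'" "j < dim_col C'"
      with *[of "m + i" j] assms show "C $$ (i, j) = C' $$ (i, j)" by simp
    qed (use assms in auto)
    show "D = D'"
    proof (rule eq_matI)
      fix i j assume "i < dim_row D'" "j < dim_col D'"
      with *[of "m + i" "p + j"] assms show "D $$ (i, j) = D' $$ (i, j)" by simp
    qed (use assms in auto)
  qed
qed simp

lemma four_block_mat_eq_zero_iff:
  assumes "A \<in> carrier_mat m p" "B \<in> carrier_mat m q" "C \<in> carrier_mat n p" "D \<in> carrier_mat n q"
  shows "four_block_mat A B C D = 0\<^sub>m (m + n) (p + q) \<longleftrightarrow>
    A = 0\<^sub>m m p \<and> B = 0\<^sub>m m q \<and> C = 0\<^sub>m n p \<and> D = 0\<^sub>m n q"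
  unfolding four_block_zero_mat[symmetric]
  by (rule four_block_mat_eq_iff) (use assms in auto)

lemma hadamard_mat_carrier [simp]:
  "A \<in> carrier_mat m n \<Longrightarrow> A \<circ>\<^sub>m B \<in> carrier_mat m n"
  unfolding hadamard_mat_def by auto

lemma hadamard_four_block_mat:
  assumes "A \<in> carrier_mat m p" "B \<in> carrier_mat m q" "C \<in> carrier_mat n p" "D \<in> carrier_mat n q"
    and "A' \<in> carrier_mat m p" "B' \<in> carrier_mat m q" "C' \<in> carrier_mat n p" "D' \<in> carrier_mat n q"
  shows "four_block_mat A B C D \<circ>\<^sub>m four_block_mat A' B' C' D' =
    four_block_mat (A \<circ>\<^sub>m A') (B \<circ>\<^sub>m B') (C \<circ>\<^sub>m C') (D \<circ>\<^sub>m D')"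
  by (rule eq_matI) (use assms in \<open>auto simp: hadamard_mat_def\<close>)

lemma hadamard_zero_right:
  fixes A :: "'a :: mult_zero mat"
  assumes "A \<in> carrier_mat m n"
  shows "A \<circ>\<^sub>m 0\<^sub>m m n = 0\<^sub>m m n"
  by (rule eq_matI) (use assms in \<open>auto simp: hadamard_mat_def\<close>)

lemma hadamard_zero_left:
  fixes A :: "'a :: mult_zero mat"
  assumes "A \<in> carrier_mat m n"
  shows "0\<^sub>m m n \<circ>\<^sub>m A = 0\<^sub>m m n"
  by (rule eq_matI) (use assms in \<open>auto simp: hadamard_mat_def\<close>)

text \<open>The nowhere-zero hypotheses act through this cancellation, which turns a Hadamard
  condition on a block into a genuine matrix equation.\<close>

lemma hadamard_eq_zero_imp:
  fixes A C :: "'a :: semiring_no_zero_divisors mat"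
  assumes "A \<in> carrier_mat m n" and "\<And>i j. i < m \<Longrightarrow> j < n \<Longrightarrow> C $$ (i, j) \<noteq> 0"
    and zero: "A \<circ>\<^sub>m C = 0\<^sub>m m n"
  shows "A = 0\<^sub>m m n"
proof (rule eq_matI)
  fix i j assume ij: "i < dim_row (0\<^sub>m m n :: 'a mat)" "j < dim_col (0\<^sub>m m n :: 'a mat)"
  have "(A \<circ>\<^sub>m C) $$ (i, j) = 0"
    using zero ij by simp
  then show "A $$ (i, j) = 0\<^sub>m m n $$ (i, j)"
    using assms(1) assms(2)[of i j] ij by (auto simp: hadamard_mat_def)
qed (use assms in auto)

lemma symmetric_mat_blocks:
  fixes X :: "'a mat"
  assumes X: "X \<in> carrier_mat (m + n) (m + n)" and sym: "X\<^sup>T = X"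
  obtains Y Z W where "Y \<in> carrier_mat m m" "Z \<in> carrier_mat m n" "W \<in> carrier_mat n n"
    "Y\<^sup>T = Y" "W\<^sup>T = W" "X = four_block_mat Y Z Z\<^sup>T W"
proof -
  obtain Y Z V W where split: "split_block X m m = (Y, Z, V, W)"
    by (metis prod_cases4)
  have c: "Y \<in> carrier_mat m m" "Z \<in> carrier_mat m n" "V \<in> carrier_mat n m" "W \<in> carrier_mat n n"
    and eq: "X = four_block_mat Y Z V W"
    using split_block[OF split, of n n] X by auto
  have "four_block_mat Y\<^sup>T V\<^sup>T Z\<^sup>T W\<^sup>T = four_block_mat Y Z V W"
    using sym unfolding eq transpose_four_block_mat[OF c] .
  then have "Y\<^sup>T = Y" "Z\<^sup>T = V" "W\<^sup>T = W"
    using c by (subst (asm) four_block_mat_eq_iff[of _ m m _ n _ n]; simp)+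
  with that c eq show ?thesis by blast
qed

section \<open>Rank and SIPP of row orthogonal matrices\<close>

text \<open>The transpose is a right inverse of P, so every y is the image of P^T y and the column
  space is the whole space.\<close>

lemma rank_row_orthogonal:
  assumes orth: "row_orthogonal P" and P: "P \<in> carrier_mat n q"
  shows "vec_space.rank n P = n"
proof -
  interpret vec_space "TYPE(real)" n .
  have PT: "P\<^sup>T \<in> carrier_mat q n"
    using P by simp
  have "\<exists>x \<in> carrier_vec q. P *\<^sub>v x = y" if y: "y \<in> carrier_vec n" for y
  proof
    have "P *\<^sub>v (P\<^sup>T *\<^sub>v y) = (P * P\<^sup>T) *\<^sub>v y"
      using assoc_mult_mat_vec[OF P PT y] by simp
    also have "P * P\<^sup>T = 1\<^sub>m n"
      using orth P by (simp add: row_orthogonal_def)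
    finally show "P *\<^sub>v (P\<^sup>T *\<^sub>v y) = y"
      using y by simp
    show "P\<^sup>T *\<^sub>v y \<in> carrier_vec q"
      using PT y by (rule mult_mat_vec_carrier)
  qed
  then have "span (set (cols P)) = carrier_vec n"
    using col_space_eq[OF P] P unfolding col_space_def by auto
  then have "rank P = vectorspace.dim class_ring (vs (carrier_vec n))"
    unfolding rank_def by simp
  also have "vs (carrier_vec n) = V"
    by (simp add: module_vec_def)
  finally show ?thesis
    unfolding dim_is_n .
qed

text \<open>Full rank is automatic, and rank is at most the number of columns, so the size clause
  holds too; only the condition on X remains.\<close>

lemma SIPP_row_orthogonal_iff:
  assumes orth: "row_orthogonal P" and P: "P \<in> carrier_mat m n"
  shows "SIPP P \<longleftrightarrow> (\<forall>X \<in> carrier_mat m m.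
    X\<^sup>T = X \<and> (X * P) \<circ>\<^sub>m P = 0\<^sub>m m n \<longrightarrow> X = 0\<^sub>m m m)"
proof -
  have "m \<le> n"
    using vec_space.rank_le_nc[OF P] rank_row_orthogonal[OF orth P] by simp
  then show ?thesis
    using rank_row_orthogonal[OF orth P] P unfolding SIPP_def by auto
qed

section \<open>Block lower triangular matrices\<close>

text \<open>Compare P P^T with the identity blockwise; the two off-diagonal blocks are transposes of
  each other, so one equation covers both.\<close>

lemma row_orthogonal_block_triangular_iff:
  assumes A: "A \<in> carrier_mat k r" and C: "C \<in> carrier_mat l r" and B: "B \<in> carrier_mat l s"
  shows "row_orthogonal (four_block_mat A (0\<^sub>m k s) C B) \<longleftrightarrow>
    row_orthogonal A \<and> A * C\<^sup>T = 0\<^sub>m k l \<and> C * C\<^sup>T + B * B\<^sup>T = 1\<^sub>m l"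
proof -
  have "(C * A\<^sup>T)\<^sup>T = A * C\<^sup>T" "(A * C\<^sup>T)\<^sup>T = C * A\<^sup>T"
    using A C by (simp_all add: transpose_mult[of _ _ r])
  then have "C * A\<^sup>T = 0\<^sub>m l k \<longleftrightarrow> A * C\<^sup>T = 0\<^sub>m k l"
    by (metis zero_transpose_mat)
  moreover have "four_block_mat A (0\<^sub>m k s) C B * (four_block_mat A (0\<^sub>m k s) C B)\<^sup>T
    = four_block_mat (A * A\<^sup>T) (A * C\<^sup>T) (C * A\<^sup>T) (C * C\<^sup>T + B * B\<^sup>T)"
    using A B C
    by (simp add: transpose_four_block_mat[of _ k r _ s _ l] mult_four_block_mat[of _ k r _ s _ l _ _ k _ l])
  moreover have "four_block_mat (A * A\<^sup>T) (A * C\<^sup>T) (C * A\<^sup>T) (C * C\<^sup>T + B * B\<^sup>T) = 1\<^sub>m (k + l) \<longleftrightarrow>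
    A * A\<^sup>T = 1\<^sub>m k \<and> A * C\<^sup>T = 0\<^sub>m k l \<and> C * A\<^sup>T = 0\<^sub>m l k \<and> C * C\<^sup>T + B * B\<^sup>T = 1\<^sub>m l"
    unfolding four_block_one_mat[symmetric]
    by (rule four_block_mat_eq_iff) (use A B C in auto)
  ultimately show ?thesis
    using A B unfolding row_orthogonal_def by auto
qed

text \<open>Since C has no zero entry, the Hadamard condition on the lower left block of X times the
  matrix is the full equation Z^T A + W C = 0. Multiplying it by A^T gives Z = 0, which
  decouples the two diagonal blocks of X. Besides Q itself, M (s = 0) and N (k = 0, r = 1) have
  this shape, so their strong inner product properties can be compared block by block.\<close>

lemma SIPP_block_triangular_iff:
  assumes A: "A \<in> carrier_mat k r" and C: "C \<in> carrier_mat l r" and B: "B \<in> carrier_mat l s"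
    and orth: "row_orthogonal (four_block_mat A (0\<^sub>m k s) C B)"
    and nz: "\<And>i j. i < l \<Longrightarrow> j < r \<Longrightarrow> C $$ (i, j) \<noteq> 0"
  shows "SIPP (four_block_mat A (0\<^sub>m k s) C B) \<longleftrightarrow>
    SIPP A \<and> (\<forall>W \<in> carrier_mat l l.
      W\<^sup>T = W \<and> W * C = 0\<^sub>m l r \<and> (W * B) \<circ>\<^sub>m B = 0\<^sub>m l s \<longrightarrow> W = 0\<^sub>m l l)"
    (is "SIPP ?Q \<longleftrightarrow> _ \<and> ?R")
proof -
  have AO: "row_orthogonal A" and AC: "A * C\<^sup>T = 0\<^sub>m k l"
    using orth unfolding row_orthogonal_block_triangular_iff[OF A C B] by auto
  have AA: "A * A\<^sup>T = 1\<^sub>m k"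
    using AO A unfolding row_orthogonal_def by auto
  have CA: "C * A\<^sup>T = 0\<^sub>m l k"
    using arg_cong[OF AC, of transpose_mat] A C by (simp add: transpose_mult[of _ _ r])
  \<comment> \<open>The upper right block is (Z B) o O, which vanishes for every Z and so gives no
    condition.\<close>
  have prod: "(four_block_mat Y Z Z\<^sup>T W * ?Q) \<circ>\<^sub>m ?Q = 0\<^sub>m (k + l) (r + s) \<longleftrightarrow>
      (Y * A + Z * C) \<circ>\<^sub>m A = 0\<^sub>m k r \<and> (Z\<^sup>T * A + W * C) \<circ>\<^sub>m C = 0\<^sub>m l r \<and>
      (W * B) \<circ>\<^sub>m B = 0\<^sub>m l s"
    if c: "Y \<in> carrier_mat k k" "Z \<in> carrier_mat k l" "W \<in> carrier_mat l l" for Y Z W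
  proof -
    have "four_block_mat Y Z Z\<^sup>T W * ?Q =
        four_block_mat (Y * A + Z * C) (Z * B) (Z\<^sup>T * A + W * C) (W * B)"
      using A B C c by (subst mult_four_block_mat[of _ k k _ l _ l _ _ r _ s]) auto
    then have "(four_block_mat Y Z Z\<^sup>T W * ?Q) \<circ>\<^sub>m ?Q =
        four_block_mat ((Y * A + Z * C) \<circ>\<^sub>m A) (0\<^sub>m k s) ((Z\<^sup>T * A + W * C) \<circ>\<^sub>m C) ((W * B) \<circ>\<^sub>m B)"
      using A B C c
      by (simp add: hadamard_four_block_mat[of _ k r _ s _ l] hadamard_zero_right[of _ k s])
    moreover have "\<dots> = 0\<^sub>m (k + l) (r + s) \<longleftrightarrow> (Y * A + Z * C) \<circ>\<^sub>m A = 0\<^sub>m k r \<and>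
        0\<^sub>m k s = (0\<^sub>m k s :: real mat) \<and>
        (Z\<^sup>T * A + W * C) \<circ>\<^sub>m C = 0\<^sub>m l r \<and> (W * B) \<circ>\<^sub>m B = 0\<^sub>m l s"
      by (rule four_block_mat_eq_zero_iff) (use A B C c in auto)
    ultimately show ?thesis by simp
  qed
  have Q: "?Q \<in> carrier_mat (k + l) (r + s)"
    using A B by auto
  note SA = SIPP_row_orthogonal_iff[OF AO A]
  note SQ = SIPP_row_orthogonal_iff[OF orth Q]
  show ?thesis
  proof
    assume "SIPP ?Q"
    then have ker: "X = 0\<^sub>m (k + l) (k + l)" if "X \<in> carrier_mat (k + l) (k + l)" "X\<^sup>T = X"
      "(X * ?Q) \<circ>\<^sub>m ?Q = 0\<^sub>m (k + l) (r + s)" for X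
      using SQ that by auto
    \<comment> \<open>Solutions Y and W of the two separate conditions form a block diagonal
      solution X for the whole matrix. Putting O for one of them tests the other alone.\<close>
    have diag: "Y = 0\<^sub>m k k \<and> W = 0\<^sub>m l l"
      if Y: "Y \<in> carrier_mat k k" "Y\<^sup>T = Y" "(Y * A) \<circ>\<^sub>m A = 0\<^sub>m k r"
        and W: "W \<in> carrier_mat l l" "W\<^sup>T = W" "W * C = 0\<^sub>m l r" "(W * B) \<circ>\<^sub>m B = 0\<^sub>m l s"
      for Y W
    proof -
      let ?X = "four_block_mat Y (0\<^sub>m k l) (0\<^sub>m k l)\<^sup>T W"
      have "?X = 0\<^sub>m (k + l) (k + l)"
      proof (rule ker)
        show "?X \<in> carrier_mat (k + l) (k + l)" using Y W by auto
        show "?X\<^sup>T = ?X"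
          using Y W by (simp add: transpose_four_block_mat[of _ k k _ l _ l])
        show "(?X * ?Q) \<circ>\<^sub>m ?Q = 0\<^sub>m (k + l) (r + s)"
          using prod[OF Y(1) zero_carrier_mat W(1)] Y W A C by (simp add: hadamard_zero_left)
      qed
      then show ?thesis
        using Y W by (subst (asm) four_block_mat_eq_zero_iff) auto
    qed
    have "Y = 0\<^sub>m k k" if "Y \<in> carrier_mat k k" "Y\<^sup>T = Y" "(Y * A) \<circ>\<^sub>m A = 0\<^sub>m k r" for Y
      using diag[OF that, of "0\<^sub>m l l"] B C by (simp add: hadamard_zero_left)
    moreover have "W = 0\<^sub>m l l" if "W \<in> carrier_mat l l" "W\<^sup>T = W" "W * C = 0\<^sub>m l r"
      "(W * B) \<circ>\<^sub>m B = 0\<^sub>m l s" for W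
      using diag[OF _ _ _ that, of "0\<^sub>m k k"] A by (simp add: hadamard_zero_left)
    ultimately show "SIPP A \<and> ?R"
      unfolding SA by blast
  next
    assume R: "SIPP A \<and> ?R"
    show "SIPP ?Q"
      unfolding SQ
    proof (intro ballI impI, elim conjE)
      fix X :: "real mat"
      assume X: "X \<in> carrier_mat (k + l) (k + l)" "X\<^sup>T = X"
        and XQ: "(X * ?Q) \<circ>\<^sub>m ?Q = 0\<^sub>m (k + l) (r + s)"
      obtain Y Z W where c: "Y \<in> carrier_mat k k" "Z \<in> carrier_mat k l" "W \<in> carrier_mat l l"
        and sym: "Y\<^sup>T = Y" "W\<^sup>T = W" and XE: "X = four_block_mat Y Z Z\<^sup>T W"
        by (rule symmetric_mat_blocks[OF X])
      have YZ: "(Y * A + Z * C) \<circ>\<^sub>m A = 0\<^sub>m k r"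
        and ZW: "(Z\<^sup>T * A + W * C) \<circ>\<^sub>m C = 0\<^sub>m l r" and WB: "(W * B) \<circ>\<^sub>m B = 0\<^sub>m l s"
        using XQ unfolding XE prod[OF c] by auto
      have ZW0: "Z\<^sup>T * A + W * C = 0\<^sub>m l r"
        by (rule hadamard_eq_zero_imp[OF _ nz ZW]) (use A C c in auto)
      have "0\<^sub>m l k = (Z\<^sup>T * A + W * C) * A\<^sup>T"
        using A by (simp add: ZW0)
      also have "\<dots> = Z\<^sup>T * A * A\<^sup>T + W * C * A\<^sup>T"
        by (rule add_mult_distrib_mat) (use A C c in auto)
      also have "Z\<^sup>T * A * A\<^sup>T = Z\<^sup>T"
        using A c AA by (subst assoc_mult_mat[of _ l k _ r _ k]) auto
      also have "W * C * A\<^sup>T = 0\<^sub>m l k"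
        using A C c CA by (subst assoc_mult_mat[of _ l l _ r _ k]) auto
      finally have "Z\<^sup>T = 0\<^sub>m l k"
        using c by simp
      then have Z: "Z = 0\<^sub>m k l"
        by (metis transpose_transpose zero_transpose_mat)
      have "W * C = 0\<^sub>m l r"
        using ZW0 A C c by (simp add: Z)
      moreover have "(Y * A) \<circ>\<^sub>m A = 0\<^sub>m k r"
        using YZ A C c by (simp add: Z)
      ultimately have "Y = 0\<^sub>m k k" "W = 0\<^sub>m l l"
        using R WB c sym unfolding SA by auto
      then show "X = 0\<^sub>m (k + l) (k + l)"
        by (simp add: XE Z)
    qed
  qed
qed

section \<open>Comparison of M, N and Q\<close>

lemma mat_of_col_carrier [simp]: "mat_of_col v \<in> carrier_mat (dim_vec v) 1"
  unfolding mat_of_col_def by auto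

lemma mat_of_col_index [simp]: "i < dim_vec v \<Longrightarrow> mat_of_col v $$ (i, 0) = v $ i"
  unfolding mat_of_col_def by (simp add: mat_of_cols_index)

theorem proposition5p6:
  fixes A B M N Q :: "real mat" and a b :: "real vec" and k r l s :: nat
  assumes "A \<in> carrier_mat k r" and "a \<in> carrier_vec r"
    and "b \<in> carrier_vec l" and "B \<in> carrier_mat l s"
    and "M = A @\<^sub>r mat_of_row a"
    and "N = mat_of_col b @\<^sub>c B"
    and "row_orthogonal M" and "row_orthogonal N"
    and "nowhere_zero a" and "nowhere_zero b"
    and "Q = four_block_mat A (0\<^sub>m k s) (mat_of_col b * mat_of_row a) B"
  shows "row_orthogonal Q \<and> (SIPP Q \<longleftrightarrow> SIPP M \<and> SIPP N)"
proof -
  define R where "R = mat_of_row a"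
  define L where "L = mat_of_col b"
  note A = assms(1) and B = assms(4)
  have R: "R \<in> carrier_mat 1 r" and L: "L \<in> carrier_mat l 1"
    using assms(2,3) mat_of_col_carrier[of b] by (auto simp: R_def L_def simp del: mat_of_col_carrier)
  have LR: "L * R \<in> carrier_mat l r"
    using L R by auto
  have Q: "Q = four_block_mat A (0\<^sub>m k s) (L * R) B"
    by (simp add: assms(11) L_def R_def)
  have M: "M = four_block_mat A (0\<^sub>m k 0) R (0\<^sub>m 1 0)"
    using A by (simp add: assms(5) append_rows_def R_def)
  have N: "N = four_block_mat (0\<^sub>m 0 1) (0\<^sub>m 0 s) L B"
    using L B unfolding assms(6) append_cols_def L_def[symmetric]
    by (intro eq_matI) auto
  have AO: "row_orthogonal A" and AR: "A * R\<^sup>T = 0\<^sub>m k 1" and RR: "R * R\<^sup>T = 1\<^sub>m 1"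
    using assms(7) R row_orthogonal_block_triangular_iff[OF A R zero_carrier_mat, of 0]
    unfolding M by auto
  have LB: "L * L\<^sup>T + B * B\<^sup>T = 1\<^sub>m l"
    using assms(8) row_orthogonal_block_triangular_iff[OF zero_carrier_mat L B, of 0]
    unfolding N by auto
  \<comment> \<open>R has the right inverse R^T, so it cancels on the right. The row count n is left
    free: M needs n = 1, Q needs n = l.\<close>
  have cancel: "W * R = 0\<^sub>m n r \<longleftrightarrow> W = 0\<^sub>m n 1" if W: "W \<in> carrier_mat n 1" for W n
  proof
    assume "W * R = 0\<^sub>m n r"
    then have "W * R * R\<^sup>T = 0\<^sub>m n 1"
      using R by simp
    then show "W = 0\<^sub>m n 1"
      using R W RR by (subst (asm) assoc_mult_mat[of _ n 1 _ r _ 1]) auto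
  qed (use R in simp)
  have "A * (L * R)\<^sup>T = A * R\<^sup>T * L\<^sup>T"
    using A R L by (simp add: transpose_mult[of _ l 1] assoc_mult_mat[of _ k r _ 1 _ l])
  then have ALR: "A * (L * R)\<^sup>T = 0\<^sub>m k l"
    using L by (simp add: AR)
  have "L * R * (L * R)\<^sup>T = L * R * (R\<^sup>T * L\<^sup>T)"
    using R L by (simp add: transpose_mult[of _ l 1])
  also have "\<dots> = L * (R * R\<^sup>T * L\<^sup>T)"
    using R L by (simp add: assoc_mult_mat[of _ l 1 _ r _ l] assoc_mult_mat[of _ 1 r _ 1 _ l])
  finally have "L * R * (L * R)\<^sup>T = L * L\<^sup>T"
    using L by (simp add: RR)
  with AO ALR LB have QO: "row_orthogonal Q"
    unfolding Q row_orthogonal_block_triangular_iff[OF A LR B] by simp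
  have Rnz: "R $$ (i, j) \<noteq> 0" if "i < 1" "j < r" for i j
    using assms(2,9) that by (simp add: R_def nowhere_zero_def)
  have Lnz: "L $$ (i, j) \<noteq> 0" if "i < l" "j < 1" for i j
    using assms(3,10) that by (simp add: L_def nowhere_zero_def)
  have LRnz: "(L * R) $$ (i, j) \<noteq> 0" if "i < l" "j < r" for i j
    using Lnz[of i 0] Rnz[of 0 j] L R that by (simp add: scalar_prod_def)
  have WLR: "W * (L * R) = 0\<^sub>m l r \<longleftrightarrow> W * L = 0\<^sub>m l 1" if "W \<in> carrier_mat l l" for W
    using cancel[of "W * L" l] that L R by (simp add: assoc_mult_mat[of _ l l _ 1 _ r])
  \<comment> \<open>Here W is 1 by 1, and \<open>cancel\<close> turns W R = O into W = O, so the
    condition on W always holds.\<close>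
  have "SIPP M \<longleftrightarrow> SIPP A"
    using SIPP_block_triangular_iff[OF A R zero_carrier_mat assms(7)[unfolded M] Rnz]
      cancel[of _ 1]
    unfolding M by auto
  moreover have "SIPP (0\<^sub>m 0 1)"
    by (subst SIPP_row_orthogonal_iff) (auto simp: row_orthogonal_def)
  then have "SIPP N \<longleftrightarrow> (\<forall>W \<in> carrier_mat l l.
      W\<^sup>T = W \<and> W * L = 0\<^sub>m l 1 \<and> (W * B) \<circ>\<^sub>m B = 0\<^sub>m l s \<longrightarrow> W = 0\<^sub>m l l)"
    using SIPP_block_triangular_iff[OF zero_carrier_mat L B assms(8)[unfolded N] Lnz]
    unfolding N by simp
  moreover have "SIPP Q \<longleftrightarrow> SIPP A \<and> (\<forall>W \<in> carrier_mat l l.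
      W\<^sup>T = W \<and> W * L = 0\<^sub>m l 1 \<and> (W * B) \<circ>\<^sub>m B = 0\<^sub>m l s \<longrightarrow> W = 0\<^sub>m l l)"
    using SIPP_block_triangular_iff[OF A LR B QO[unfolded Q] LRnz] WLR
    unfolding Q by auto
  ultimately show ?thesis
    using QO by blast
qed

end
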